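(* Let $n\in\mathbb{N}$, $x^{(0)}\in\mathbb{R}^n$, $R>0$, and $B=B(x^{(0)};R)$. Let $S$ be a nondegenerate simplex with vertices $x^{(1)},\dots,x^{(n+1)}\in B$, let $P:C(B)\to\Pi_1(\mathbb{R}^n)$ be the interpolation projector with nodes $x^{(1)},\dots,x^{(n+1)}$, and let $\lambda_j(x)=l_{1j}x_1+\dots+l_{nj}x_n+l_{n+1,j}$, $1\le j\le n+1$, be the basic Lagrange polynomials of $S$. Then $$\|P\|_B=\max_{f_j=\pm1}\left[R\left(\sum_{i=1}^n\Big(\sum_{j=1}^{n+1}f_jl_{ij}\Big)^2\right)^{1/2}+\left|\sum_{j=1}^{n+1}f_j\Big(\sum_{i=1}^n l_{ij}x_i^{(0)}+l_{n+1,j}\Big)\right|\right]$$ $$=\max_{f_j=\pm1}\left[R\left(\sum_{i=1}^n\Big(\sum_{j=1}^{n+1}f_jl_{ij}\Big)^2\right)^{1/2}+\left|\sum_{j=1}^{n+1}f_j\lambda_j(x^{(0)})\right|\right],$$ where each maximum is taken over all $(f_1,\dots,f_{n+1})\in\{-1,1\}^{n+1}$.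
   Context: $\|x\|=\left(\sum_{i=1}^n x_i^2\right)^{1/2}$ is the Euclidean norm on $\mathbb{R}^n$, and $B(x^{(0)};R)=\{x\in\mathbb{R}^n:\|x-x^{(0)}\|\le R\}$. $C(B)$ is the space of continuous functions $f:B\to\mathbb{R}$ with norm $\|f\|_{C(B)}=\max_{x\in B}|f(x)|$. $\Pi_1(\mathbb{R}^n)$ is the set of real polynomials in $n$ variables of degree at most $1$. A simplex with vertices $x^{(1)},\dots,x^{(n+1)}\in\mathbb{R}^n$ is nondegenerate if these points are affinely independent; equivalently, the vertex matrix $\mathbf{A}$ (of order $n+1$), whose $j$th row is $(x_1^{(j)},\dots,x_n^{(j)},1)$, is invertible. Write $\mathbf{A}^{-1}=(l_{ij})$. The basic Lagrange polynomials of $S$ are $\lambda_j(x)=l_{1j}x_1+\dots+l_{nj}x_n+l_{n+1,j}$; they satisfy $\lambda_j(x^{(k)})=\delta_j^k$. The interpolation projector $P:C(B)\to\Pi_1(\mathbb{R}^n)$ with nodes $x^{(j)}\in B$ (corresponding to $S$) is determined by $Pf(x^{(j)})=f(x^{(j)})$ for $1\le j\le n+1$. $\|P\|_B$ is the norm of $P$ as an operator from $C(B)$ to $C(B)$ (with $Pf$ restricted to $B$). *)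

theory Defs
  imports "HOL-Analysis.Analysis"
begin

text \<open>
  The dimension is \<open>n = CARD('n)\<close>. The type \<open>'n option\<close> has \<open>n + 1\<close> elements and indexes both
  the vertices of a simplex and the columns of its vertex matrix; as a column index, \<open>Some i\<close>
  stands for the coordinate \<open>i\<close> and \<open>None\<close> for the additional last column of ones.
\<close>

definition nondegenerate_simplex :: "('n option \<Rightarrow> real ^ 'n) \<Rightarrow> bool" where
  "nondegenerate_simplex x \<longleftrightarrow> inj x \<and> \<not> affine_dependent (range x)"

definition vertex_matrix :: "('n::finite option \<Rightarrow> real ^ 'n) \<Rightarrow> real ^ 'n option ^ 'n option" where
  "vertex_matrix x = (\<chi> j k. case k of Some i \<Rightarrow> x j $ i | None \<Rightarrow> 1)"

definition lagrange_coeff ::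
    "('n::finite option \<Rightarrow> real ^ 'n) \<Rightarrow> 'n option \<Rightarrow> 'n option \<Rightarrow> real" where
  "lagrange_coeff x i j = matrix_inv (vertex_matrix x) $ i $ j"

definition lagrange_poly ::
    "('n::finite option \<Rightarrow> real ^ 'n) \<Rightarrow> 'n option \<Rightarrow> real ^ 'n \<Rightarrow> real" where
  "lagrange_poly x j y =
     (\<Sum>i\<in>UNIV. lagrange_coeff x (Some i) j * y $ i) + lagrange_coeff x None j"

text \<open>Real polynomials of degree at most 1, as functions.\<close>

definition Pi1 :: "(real ^ 'n \<Rightarrow> real) set" where
  "Pi1 = {p. \<exists>a b. p = (\<lambda>y. (\<Sum>i\<in>UNIV. a $ i * y $ i) + b)}"

text \<open>
  Elements of \<open>C(B)\<close> are represented by total functions that are continuous on \<open>B\<close>; an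
  interpolation projector only looks at values in \<open>B\<close>, since the nodes lie there.
  For nonempty compact \<open>B\<close> the supremum in \<open>C_norm\<close> is a maximum.
\<close>

definition C_norm :: "'a::topological_space set \<Rightarrow> ('a \<Rightarrow> real) \<Rightarrow> real" where
  "C_norm B f = (SUP y\<in>B. \<bar>f y\<bar>)"

definition C_opnorm ::
    "'a::topological_space set \<Rightarrow> (('a \<Rightarrow> real) \<Rightarrow> 'a \<Rightarrow> real) \<Rightarrow> real" where
  "C_opnorm B P = (SUP f\<in>{f. continuous_on B f \<and> C_norm B f \<le> 1}. C_norm B (P f))"

definition interpolation_projector ::
    "(real ^ 'n) set \<Rightarrow> ('n option \<Rightarrow> real ^ 'n) \<Rightarrow>
     ((real ^ 'n \<Rightarrow> real) \<Rightarrow> real ^ 'n \<Rightarrow> real) \<Rightarrow> bool" where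
  "interpolation_projector B x P \<longleftrightarrow>
     (\<forall>f. continuous_on B f \<longrightarrow> P f \<in> Pi1 \<and> (\<forall>j. P f (x j) = f (x j)))"

definition sign_vectors :: "('j \<Rightarrow> real) set" where
  "sign_vectors = {f. \<forall>j. f j \<in> {- 1, 1}}"

end

theory Submission
  imports Defs
begin

text \<open>
  Interpolation is linear with \<open>P f = (\<Sum>j. f (x j) * \<lambda>\<^sub>j)\<close>
  (\<open>interpolation_projector_eq\<close>), so \<open>P f\<close> on \<open>B\<close> depends only on the finitely many nodal values
  \<open>f (x j)\<close>, and for \<open>f\<close> in the unit ball of \<open>C(B)\<close> these lie in \<open>[-1, 1]\<close>. At a fixed point, the
  largest value of \<open>\<bar>P f\<bar>\<close> over such data is reached at the signs of the \<open>\<lambda>\<^sub>j\<close> there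
  (\<open>ex_sign_vector_sum_ge\<close>), so only sign vectors \<open>s\<close> matter. For each of them,
  \<open>(\<Sum>j. s j * \<lambda>\<^sub>j)\<close> is an affine function, and the maximum on a ball of the absolute value of an
  affine function is its absolute value at the centre plus \<open>R\<close> times the norm of its gradient
  (\<open>abs_affine_le_on_cball\<close>, \<open>abs_affine_attained_on_cball\<close>). This is the expression whose maximum
  over \<open>s\<close> is taken.

  Conversely, every sign vector is the nodal data of a continuous function of norm at most \<open>1\<close>:
  truncate \<open>(\<Sum>j. s j * \<lambda>\<^sub>j)\<close> to the range \<open>[-1, 1]\<close>, which does not change its values
  \<open>\<plusminus>1\<close> at the nodes. So no sign vector is lost and the bound is attained.
\<close>

lemma sum_UNIV_option:
  fixes g :: "'a::finite option \<Rightarrow> 'b::comm_monoid_add"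
  shows "(\<Sum>i\<in>UNIV. g i) = (\<Sum>i\<in>UNIV. g (Some i)) + g None"
  by (simp add: UNIV_option_conv sum.reindex add.commute)

lemma finite_sign_vectors: "finite (sign_vectors :: ('j::finite \<Rightarrow> real) set)"
proof -
  have "sign_vectors = (UNIV :: 'j set) \<rightarrow>\<^sub>E {- 1, 1 :: real}"
    by (auto simp: sign_vectors_def PiE_def Pi_def)
  moreover have "finite ((UNIV :: 'j set) \<rightarrow>\<^sub>E {- 1, 1 :: real})"
    by (intro finite_PiE) auto
  ultimately show ?thesis
    by simp
qed

lemma sign_vectors_nonempty: "sign_vectors \<noteq> {}"
  by (auto simp: sign_vectors_def intro!: exI[of _ "\<lambda>_. 1"])

lemma ex_sign_vector_sum_ge:
  fixes c v :: "'j::finite \<Rightarrow> real"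
  assumes "\<And>j. \<bar>v j\<bar> \<le> 1"
  shows "\<exists>s\<in>sign_vectors. \<bar>\<Sum>j\<in>UNIV. v j * c j\<bar> \<le> (\<Sum>j\<in>UNIV. s j * c j)"
proof
  \<comment> \<open>At \<open>0\<close> the function \<open>sgn\<close> would not give a sign vector, hence the case distinction.\<close>
  let ?s = "\<lambda>j. if c j \<ge> 0 then 1 else - 1 :: real"
  show "?s \<in> sign_vectors"
    by (simp add: sign_vectors_def)
  have "\<bar>\<Sum>j\<in>UNIV. v j * c j\<bar> \<le> (\<Sum>j\<in>UNIV. \<bar>v j * c j\<bar>)"
    by (rule sum_abs)
  also have "\<dots> \<le> (\<Sum>j\<in>UNIV. \<bar>c j\<bar>)"
    using assms by (intro sum_mono) (simp add: abs_mult mult_left_le_one_le)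
  also have "\<dots> = (\<Sum>j\<in>UNIV. ?s j * c j)"
    by (intro sum.cong) auto
  finally show "\<bar>\<Sum>j\<in>UNIV. v j * c j\<bar> \<le> (\<Sum>j\<in>UNIV. ?s j * c j)" .
qed

section \<open>Affine functions on a ball\<close>

lemma abs_affine_le_on_cball:
  fixes a y x0 :: "'a::real_inner"
  assumes "y \<in> cball x0 R"
  shows "\<bar>a \<bullet> y + b\<bar> \<le> R * norm a + \<bar>a \<bullet> x0 + b\<bar>"
proof -
  have "a \<bullet> y + b = a \<bullet> (y - x0) + (a \<bullet> x0 + b)"
    by (simp add: inner_diff_right)
  moreover have "\<bar>a \<bullet> (y - x0)\<bar> \<le> norm a * norm (y - x0)"
    by (rule Cauchy_Schwarz_ineq2)
  moreover have "norm a * norm (y - x0) \<le> norm a * R"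
    using assms by (intro mult_left_mono) (auto simp: dist_norm norm_minus_commute)
  ultimately show ?thesis
    by (simp add: mult.commute)
qed

text \<open>
  Equality holds at the boundary point reached from the centre along the gradient or against it,
  in the direction in which the value at the centre grows in absolute value.
\<close>

lemma abs_affine_attained_on_cball:
  fixes a x0 :: "'a::real_inner"
  assumes "R \<ge> 0"
  shows "\<exists>y\<in>cball x0 R. \<bar>a \<bullet> y + b\<bar> = R * norm a + \<bar>a \<bullet> x0 + b\<bar>"
proof
  define e :: real where "e = (if a \<bullet> x0 + b \<ge> 0 then 1 else - 1)"
  \<comment> \<open>For \<open>a = 0\<close> this is \<open>x0\<close>, since \<open>sgn 0 = 0\<close>.\<close>
  let ?y = "x0 + (e * R) *\<^sub>R sgn a"
  have "\<bar>e\<bar> = 1"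
    by (simp add: e_def)
  then show "?y \<in> cball x0 R"
    using assms by (simp add: dist_norm abs_mult norm_sgn)
  have "a \<bullet> sgn a = norm a"
    by (cases "a = 0") (simp_all add: sgn_div_norm power2_norm_eq_inner[symmetric] power2_eq_square)
  then have "a \<bullet> ?y + b = e * (R * norm a) + (a \<bullet> x0 + b)"
    by (simp add: inner_add_right)
  moreover have "0 \<le> R * norm a"
    using assms by simp
  ultimately show "\<bar>a \<bullet> ?y + b\<bar> = R * norm a + \<bar>a \<bullet> x0 + b\<bar>"
    by (simp add: e_def split: if_splits)
qed

section \<open>Lagrange polynomials of a nondegenerate simplex\<close>

lemma matrix_inv:
  fixes A :: "'a::semiring_1 ^ 'n ^ 'm"
  assumes "invertible A"
  shows "A ** matrix_inv A = mat 1" and "matrix_inv A ** A = mat 1"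
  using someI_ex[OF assms[unfolded invertible_def]] by (simp_all add: matrix_inv_def)

text \<open>
  A row vector annihilated by the vertex matrix has coordinate sum \<open>0\<close>, by the column of ones, and
  combines the vertices to \<open>0\<close>, by the other columns: it is an affine dependence of the vertices.
\<close>

lemma invertible_vertex_matrix:
  fixes x :: "'n::finite option \<Rightarrow> real ^ 'n"
  assumes "nondegenerate_simplex x"
  shows "invertible (vertex_matrix x)"
proof -
  have inj: "inj x" and indep: "\<not> affine_dependent (range x)"
    using assms by (auto simp: nondegenerate_simplex_def)
  have "v = 0" if v: "transpose (vertex_matrix x) *v v = 0" for v
  proof -
    have col: "(\<Sum>j\<in>UNIV. vertex_matrix x $ j $ k * v $ j) = 0" for k
      using arg_cong[OF v, of "\<lambda>w. w $ k"]
      by (simp add: matrix_vector_mult_def transpose_def)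
    let ?u = "\<lambda>p. v $ the_inv x p"
    have u: "?u (x j) = v $ j" for j
      using inj by (simp add: the_inv_f_f)
    have "sum ?u (range x) = 0"
      using col[of None] by (simp add: sum.reindex[OF inj] u vertex_matrix_def)
    moreover have "(\<Sum>p\<in>range x. ?u p *\<^sub>R p) = 0"
      using col[of "Some _"]
      by (simp add: sum.reindex[OF inj] u vertex_matrix_def vec_eq_iff mult.commute)
    ultimately have "\<forall>p\<in>range x. ?u p = 0"
      using indep by (force simp: affine_dependent_explicit_finite)
    then show "v = 0"
      by (simp add: u vec_eq_iff)
  qed
  then obtain M where "M ** transpose (vertex_matrix x) = mat 1"
    using matrix_left_invertible_ker[of "transpose (vertex_matrix x)"] by blast
  then have "vertex_matrix x ** transpose M = mat 1"
    by (metis matrix_transpose_mul transpose_mat transpose_transpose)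
  then show ?thesis
    by (auto simp: invertible_right_inverse)
qed

text \<open>This is the identity \<open>A ** A\<inverse> = 1\<close> for the vertex matrix \<open>A\<close>, read entrywise.\<close>

lemma lagrange_poly_vertex:
  assumes "nondegenerate_simplex x"
  shows "lagrange_poly x j (x k) = (if k = j then 1 else 0)"
proof -
  have "vertex_matrix x ** matrix_inv (vertex_matrix x) = mat 1"
    by (simp add: invertible_vertex_matrix[OF assms] matrix_inv(1))
  from arg_cong[OF this, of "\<lambda>M. M $ k $ j"] show ?thesis
    by (simp add: matrix_matrix_mult_def mat_def sum_UNIV_option vertex_matrix_def
        lagrange_poly_def lagrange_coeff_def mult.commute)
qed

text \<open>
  The vertex matrix maps the coefficients of an affine function to its values at the vertices, so
  \<open>A\<inverse>\<close> recovers the coefficients from these values; its columns hold the coefficients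
  of the Lagrange polynomials.
\<close>

lemma Pi1_lagrange_expansion:
  assumes "nondegenerate_simplex x" and "p \<in> Pi1"
  shows "p y = (\<Sum>j\<in>UNIV. p (x j) * lagrange_poly x j y)"
proof -
  let ?A = "vertex_matrix x"
  obtain a b where p: "\<And>z. p z = (\<Sum>i\<in>UNIV. a $ i * z $ i) + b"
    using assms(2) by (auto simp: Pi1_def)
  define c where "c = (\<chi> k. case k of Some i \<Rightarrow> a $ i | None \<Rightarrow> b)"
  have Ac: "(?A *v c) $ j = p (x j)" for j
    by (simp add: matrix_vector_mult_def sum_UNIV_option vertex_matrix_def c_def p mult.commute)
  have "matrix_inv ?A *v (?A *v c) = c"
    by (simp add: matrix_vector_mul_assoc invertible_vertex_matrix[OF assms(1)] matrix_inv(2))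
  then have c: "c $ k = (\<Sum>j\<in>UNIV. lagrange_coeff x k j * p (x j))" for k
    by (simp add: matrix_vector_mult_def lagrange_coeff_def vec_eq_iff flip: Ac)
  have "p y = (\<Sum>i\<in>UNIV. c $ Some i * y $ i) + c $ None"
    by (simp add: p c_def)
  also have "\<dots> = (\<Sum>i\<in>UNIV. \<Sum>j\<in>UNIV. lagrange_coeff x (Some i) j * p (x j) * y $ i)
      + (\<Sum>j\<in>UNIV. lagrange_coeff x None j * p (x j))"
    by (simp only: c sum_distrib_right)
  also have "\<dots> = (\<Sum>j\<in>UNIV. p (x j) * lagrange_poly x j y)"
    by (subst sum.swap)
      (simp add: lagrange_poly_def sum_distrib_left sum.distrib distrib_left ac_simps)
  finally show ?thesis .
qed

lemma interpolation_projector_eq: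
  assumes "nondegenerate_simplex x" and "interpolation_projector B x P" and "continuous_on B f"
  shows "P f y = (\<Sum>j\<in>UNIV. f (x j) * lagrange_poly x j y)"
  using assms Pi1_lagrange_expansion[OF assms(1), of "P f" y]
  by (simp add: interpolation_projector_def)

definition lagrange_gradient ::
    "('n::finite option \<Rightarrow> real ^ 'n) \<Rightarrow> ('n option \<Rightarrow> real) \<Rightarrow> real ^ 'n" where
  "lagrange_gradient x s = (\<chi> i. \<Sum>j\<in>UNIV. s j * lagrange_coeff x (Some i) j)"

lemma sum_lagrange_poly_affine:
  "(\<Sum>j\<in>UNIV. s j * lagrange_poly x j y)
     = lagrange_gradient x s \<bullet> y + (\<Sum>j\<in>UNIV. s j * lagrange_coeff x None j)"
proof -
  have "lagrange_gradient x s \<bullet> y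
      = (\<Sum>j\<in>UNIV. \<Sum>i\<in>UNIV. s j * lagrange_coeff x (Some i) j * y $ i)"
    by (subst sum.swap) (simp add: lagrange_gradient_def inner_vec_def sum_distrib_right)
  then show ?thesis
    by (simp add: lagrange_poly_def sum_distrib_left sum.distrib distrib_left mult.assoc)
qed

lemma norm_lagrange_gradient:
  "norm (lagrange_gradient x s)
     = sqrt (\<Sum>i\<in>UNIV. (\<Sum>j\<in>UNIV. s j * lagrange_coeff x (Some i) j)\<^sup>2)"
  by (simp add: norm_vec_def L2_set_def lagrange_gradient_def)

section \<open>Norm of the interpolation projector\<close>

lemma C_norm_le:
  assumes "B \<noteq> {}" and "\<And>y. y \<in> B \<Longrightarrow> \<bar>f y\<bar> \<le> M"
  shows "C_norm B f \<le> M"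
  unfolding C_norm_def using assms by (intro cSUP_least) auto

lemma abs_le_C_norm:
  assumes "\<And>y. y \<in> B \<Longrightarrow> \<bar>f y\<bar> \<le> M" and "z \<in> B"
  shows "\<bar>f z\<bar> \<le> C_norm B f"
  unfolding C_norm_def using assms by (intro cSUP_upper) (auto intro!: bdd_aboveI2)

lemma abs_le_C_norm_continuous:
  assumes "compact B" and "continuous_on B f" and "z \<in> B"
  shows "\<bar>f z\<bar> \<le> C_norm B f"
proof -
  have "bounded (f ` B)"
    using assms by (intro compact_imp_bounded compact_continuous_image)
  then obtain M where "\<And>y. y \<in> B \<Longrightarrow> \<bar>f y\<bar> \<le> M"
    by (auto simp: bounded_iff)
  then show ?thesis
    using assms(3) by (rule abs_le_C_norm)
qed

lemma continuous_on_lagrange_poly: "continuous_on B (lagrange_poly x j)"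
  unfolding lagrange_poly_def by (intro continuous_intros)

text \<open>
  The combination of Lagrange polynomials with coefficients \<open>s\<close> has the right nodal values, and
  truncating it to \<open>[-1, 1]\<close> keeps these, because they are the end points of this interval.
\<close>

lemma ex_unit_ball_with_nodal_signs:
  assumes "nondegenerate_simplex x" and "s \<in> sign_vectors"
  shows "\<exists>f. continuous_on B f \<and> (\<forall>y. \<bar>f y\<bar> \<le> 1) \<and> (\<forall>j. f (x j) = s j)"
proof -
  let ?g = "\<lambda>y. \<Sum>j\<in>UNIV. s j * lagrange_poly x j y"
  let ?f = "\<lambda>y. max (- 1) (min 1 (?g y))"
  have "continuous_on B ?f"
    by (intro continuous_intros continuous_on_lagrange_poly)
  moreover have "?f (x k) = s k" for k
  proof -
    have "?g (x k) = s k"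
      by (simp add: lagrange_poly_vertex[OF assms(1)] if_distrib cong: if_cong)
    moreover have "s k = - 1 \<or> s k = 1"
      using assms(2) by (auto simp: sign_vectors_def)
    ultimately show ?thesis
      by auto
  qed
  moreover have "\<bar>?f y\<bar> \<le> 1" for y
    by auto
  ultimately show ?thesis
    by (intro exI[of _ ?f]) blast
qed

lemma C_opnorm_interpolation_projector:
  fixes x :: "'n::finite option \<Rightarrow> real ^ 'n"
  assumes "R \<ge> 0" and simplex: "nondegenerate_simplex x" and nodes: "\<And>j. x j \<in> cball x0 R"
    and proj: "interpolation_projector (cball x0 R) x P"
  shows "C_opnorm (cball x0 R) P =
    (MAX s\<in>sign_vectors.
       R * norm (lagrange_gradient x s) + \<bar>\<Sum>j\<in>UNIV. s j * lagrange_poly x j x0\<bar>)"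
    (is "_ = Max (?V ` _)")
proof (rule antisym)
  let ?B = "cball x0 R" and ?M = "Max (?V ` sign_vectors)"
  let ?U = "{f. continuous_on ?B f \<and> C_norm ?B f \<le> 1}"
  have B: "?B \<noteq> {}"
    using assms(1) by simp
  have bound: "\<bar>P f y\<bar> \<le> ?M" if f: "f \<in> ?U" and y: "y \<in> ?B" for f y
  proof -
    have "\<bar>f (x j)\<bar> \<le> 1" for j
      using f abs_le_C_norm_continuous[OF compact_cball _ nodes[of j], of f] by auto
    then obtain s where s: "s \<in> sign_vectors"
      and le: "\<bar>\<Sum>j\<in>UNIV. f (x j) * lagrange_poly x j y\<bar> \<le> (\<Sum>j\<in>UNIV. s j * lagrange_poly x j y)"
      using ex_sign_vector_sum_ge[of "\<lambda>j. f (x j)" "\<lambda>j. lagrange_poly x j y"] by blast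
    have "\<bar>P f y\<bar> \<le> (\<Sum>j\<in>UNIV. s j * lagrange_poly x j y)"
      using le f by (simp add: interpolation_projector_eq[OF simplex proj])
    also have "\<dots> \<le> ?V s"
      unfolding sum_lagrange_poly_affine using abs_affine_le_on_cball[OF y] by (meson abs_le_D1)
    also have "\<dots> \<le> ?M"
      using s finite_sign_vectors by (intro Max_ge) auto
    finally show ?thesis .
  qed
  have norm_bound: "C_norm ?B (P f) \<le> ?M" if "f \<in> ?U" for f
    using bound[OF that] B by (intro C_norm_le)
  have attained: "\<exists>f\<in>?U. ?V s \<le> C_norm ?B (P f)" if s: "s \<in> sign_vectors" for s
  proof -
    obtain f where f: "continuous_on ?B f" "\<And>y. \<bar>f y\<bar> \<le> 1" "\<And>j. f (x j) = s j"
      using ex_unit_ball_with_nodal_signs[OF simplex s] by blast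
    have fU: "f \<in> ?U"
      using f C_norm_le[OF B, of f 1] by simp
    obtain y where y: "y \<in> ?B" and eq: "\<bar>\<Sum>j\<in>UNIV. s j * lagrange_poly x j y\<bar> = ?V s"
      unfolding sum_lagrange_poly_affine using abs_affine_attained_on_cball[OF assms(1)] by blast
    have "?V s = \<bar>P f y\<bar>"
      using eq f by (simp add: interpolation_projector_eq[OF simplex proj])
    also have "\<dots> \<le> C_norm ?B (P f)"
      using bound[OF fU] y by (rule abs_le_C_norm)
    finally show ?thesis
      using fU by blast
  qed
  have U: "?U \<noteq> {}"
    using attained sign_vectors_nonempty by blast
  show "C_opnorm ?B P \<le> ?M"
    unfolding C_opnorm_def using U norm_bound by (intro cSUP_least)
  have "?V s \<le> C_opnorm ?B P" if s: "s \<in> sign_vectors" for s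
  proof -
    obtain f where f: "f \<in> ?U" and le: "?V s \<le> C_norm ?B (P f)"
      using attained[OF s] by blast
    have "C_norm ?B (P f) \<le> C_opnorm ?B P"
      unfolding C_opnorm_def using f norm_bound by (intro cSUP_upper bdd_aboveI2)
    with le show ?thesis
      by linarith
  qed
  then show "?M \<le> C_opnorm ?B P"
    using finite_sign_vectors sign_vectors_nonempty by (intro Max.boundedI) auto
qed

theorem theorem1:
  fixes x0 :: "real ^ 'n" and R :: real and B :: "(real ^ 'n) set"
    and x :: "'n option \<Rightarrow> real ^ 'n"
    and P :: "(real ^ 'n \<Rightarrow> real) \<Rightarrow> real ^ 'n \<Rightarrow> real"
  assumes "R > 0" and "B = cball x0 R"
    and "nondegenerate_simplex x" and "\<And>j. x j \<in> B"
    and "interpolation_projector B x P"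
  defines "l \<equiv> lagrange_coeff x"
  shows "C_opnorm B P =
           (MAX f\<in>sign_vectors.
              R * sqrt (\<Sum>i\<in>UNIV. (\<Sum>j\<in>UNIV. f j * l (Some i) j)\<^sup>2)
              + \<bar>\<Sum>j\<in>UNIV. f j * ((\<Sum>i\<in>UNIV. l (Some i) j * x0 $ i) + l None j)\<bar>)
       \<and> (MAX f\<in>sign_vectors.
              R * sqrt (\<Sum>i\<in>UNIV. (\<Sum>j\<in>UNIV. f j * l (Some i) j)\<^sup>2)
              + \<bar>\<Sum>j\<in>UNIV. f j * ((\<Sum>i\<in>UNIV. l (Some i) j * x0 $ i) + l None j)\<bar>)
         = (MAX f\<in>sign_vectors.
              R * sqrt (\<Sum>i\<in>UNIV. (\<Sum>j\<in>UNIV. f j * l (Some i) j)\<^sup>2)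
              + \<bar>\<Sum>j\<in>UNIV. f j * lagrange_poly x j x0\<bar>)"
  using C_opnorm_interpolation_projector[of R x x0 P] assms(1-5)
  by (simp add: l_def norm_lagrange_gradient lagrange_poly_def)

end
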